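(* Let $F_n$ be the free group on $n$ generators and let $w\in F_n$ be any surjective word. Then for any integer $d$, the power $w^d$ is weakly profinitely rigid.
   Context: For $w\in F_n$ and a group $G$, $G_w=\{w(g_1,\dots,g_n)\mid g_1,\dots,g_n\in G\}$ is the image of the word map of $w$ on $G$ (substituting $g_i$ for the $i$-th generator). A word $w\in F_n$ is surjective if $G_w=G$ for every group $G$. Two elements $g,h$ of a group $H$ are endomorphic equivalent if there exist endomorphisms $\phi_1,\phi_2$ of $H$ (not necessarily distinct) with $\phi_1(g)=h$ and $\phi_2(h)=g$. A word $w\in F_n$ is weakly profinitely rigid if every $u\in F_n$ with $G_u=G_w$ for every finite group $G$ is endomorphic equivalent to $w$ in $F_n$. *)

theory Defs
  imports "HOL-Algebra.Elementary_Groups" "HOL-Library.Countable_Set"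
begin

section \<open>The free group on \<open>n\<close> generators\<close>

text \<open>
  The generators are indexed by \<open>0, \<dots>, n - 1\<close>. The letter \<open>(i, True)\<close> stands for the generator
  \<open>x\<^sub>i\<close> and \<open>(i, False)\<close> for its inverse. Elements of the free group are the reduced words.
\<close>

type_synonym word = "(nat \<times> bool) list"

definition reduced :: "word \<Rightarrow> bool" where
  "reduced w \<longleftrightarrow> successively (\<lambda>(i, b) (j, c). \<not> (i = j \<and> b \<noteq> c)) w"

fun cancel_cons :: "nat \<times> bool \<Rightarrow> word \<Rightarrow> word" where
  "cancel_cons l [] = [l]"
| "cancel_cons (i, b) ((j, c) # w) = (if i = j \<and> b \<noteq> c then w else (i, b) # (j, c) # w)"

definition free_group :: "nat \<Rightarrow> word monoid" where
  "free_group n =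
     \<lparr>carrier = {w. reduced w \<and> fst ` set w \<subseteq> {..<n}},
      mult = (\<lambda>u v. foldr cancel_cons u v),
      one = []\<rparr>"


section \<open>Word maps\<close>

definition letter_val :: "('a, 'b) monoid_scheme \<Rightarrow> (nat \<Rightarrow> 'a) \<Rightarrow> nat \<times> bool \<Rightarrow> 'a" where
  "letter_val G g l = (if snd l then g (fst l) else inv\<^bsub>G\<^esub> g (fst l))"

definition word_eval :: "('a, 'b) monoid_scheme \<Rightarrow> (nat \<Rightarrow> 'a) \<Rightarrow> word \<Rightarrow> 'a" where
  "word_eval G g w = foldr (\<lambda>l a. letter_val G g l \<otimes>\<^bsub>G\<^esub> a) w \<one>\<^bsub>G\<^esub>"

definition word_image :: "nat \<Rightarrow> ('a, 'b) monoid_scheme \<Rightarrow> word \<Rightarrow> 'a set" where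
  "word_image n G w = {word_eval G g w | g. g \<in> {..<n} \<rightarrow> carrier G}"

text \<open>
  A HOL formula cannot quantify over the type of the elements of a group, so the group variables
  in the next two definitions range over groups with carrier in \<open>nat\<close>. This loses nothing:
  lemmas \<open>surjective_wordD\<close> and \<open>finite_groups_universe\<close> below recover the same properties for
  groups over arbitrary types.
\<close>

definition surjective_word :: "nat \<Rightarrow> word \<Rightarrow> bool" where
  "surjective_word n w \<longleftrightarrow>
     w \<in> carrier (free_group n) \<and>
     (\<forall>G :: nat monoid. group G \<longrightarrow> word_image n G w = carrier G)"

definition endomorphic_equivalent :: "('a, 'b) monoid_scheme \<Rightarrow> 'a \<Rightarrow> 'a \<Rightarrow> bool" where
  "endomorphic_equivalent H g h \<longleftrightarrow>
     g \<in> carrier H \<and> h \<in> carrier H \<and>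
     (\<exists>\<phi>\<^sub>1 \<in> hom H H. \<exists>\<phi>\<^sub>2 \<in> hom H H. \<phi>\<^sub>1 g = h \<and> \<phi>\<^sub>2 h = g)"

definition weakly_profinitely_rigid :: "nat \<Rightarrow> word \<Rightarrow> bool" where
  "weakly_profinitely_rigid n w \<longleftrightarrow>
     w \<in> carrier (free_group n) \<and>
     (\<forall>u \<in> carrier (free_group n).
        (\<forall>G :: nat monoid. group G \<and> finite (carrier G) \<longrightarrow> word_image n G u = word_image n G w) \<longrightarrow>
        endomorphic_equivalent (free_group n) u w)"


section \<open>The group structure and the universal property\<close>

lemma reduced_Nil [simp]: "reduced []"
  by (simp add: reduced_def)

lemma reduced_ConsD: "reduced (l # w) \<Longrightarrow> reduced w"
  by (cases w) (auto simp: reduced_def)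

lemma reduced_cancel_cons: "reduced w \<Longrightarrow> reduced (cancel_cons l w)"
  by (cases "(l, w)" rule: cancel_cons.cases) (auto simp: reduced_def successively_Cons)

lemma cancel_cons_reduced: "reduced (l # w) \<Longrightarrow> cancel_cons l w = l # w"
  by (cases "(l, w)" rule: cancel_cons.cases) (auto simp: reduced_def)

lemma cancel_cons_inverse:
  assumes "reduced w" "b \<noteq> c"
  shows "cancel_cons (i, b) (cancel_cons (i, c) w) = w"
proof (cases w)
  case (Cons m w')
  then show ?thesis
    using assms by (cases m; cases w') (auto simp: reduced_def)
qed (use assms in auto)

lemma set_cancel_cons: "set (cancel_cons l w) \<subseteq> insert l (set w)"
  by (cases "(l, w)" rule: cancel_cons.cases) auto

lemma reduced_foldr: "reduced v \<Longrightarrow> reduced (foldr cancel_cons u v)"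
  by (induction u) (auto intro: reduced_cancel_cons)

lemma set_foldr_cancel_cons: "set (foldr cancel_cons u v) \<subseteq> set u \<union> set v"
proof (induction u)
  case (Cons l u)
  then show ?case using set_cancel_cons[of l "foldr cancel_cons u v"] by auto
qed simp

lemma foldr_cancel_cons_Nil: "reduced u \<Longrightarrow> foldr cancel_cons u [] = u"
proof (induction u)
  case (Cons l u)
  then show ?case using reduced_ConsD[of l u] by (simp add: cancel_cons_reduced)
qed simp

lemma foldr_cancel_cons_cancel_cons:
  assumes "reduced v"
  shows "foldr cancel_cons (cancel_cons l u) v = cancel_cons l (foldr cancel_cons u v)"
  using assms
  by (cases "(l, u)" rule: cancel_cons.cases) (auto simp: cancel_cons_inverse reduced_foldr)

lemma foldr_cancel_cons_assoc:
  assumes "reduced w"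
  shows "foldr cancel_cons (foldr cancel_cons u v) w = foldr cancel_cons u (foldr cancel_cons v w)"
  by (induction u) (auto simp: foldr_cancel_cons_cancel_cons[OF assms])

definition word_inv :: "word \<Rightarrow> word" where
  "word_inv w = rev (map (\<lambda>(i, b). (i, \<not> b)) w)"

lemma reduced_word_inv: "reduced w \<Longrightarrow> reduced (word_inv w)"
  unfolding reduced_def word_inv_def successively_rev successively_map
  by (erule successively_mono) auto

lemma foldr_cancel_cons_word_inv: "reduced v \<Longrightarrow> foldr cancel_cons (word_inv u) (foldr cancel_cons u v) = v"
proof (induction u arbitrary: v)
  case (Cons l u)
  obtain i b where "l = (i, b)" by force
  with Cons show ?case
    by (simp add: word_inv_def cancel_cons_inverse reduced_foldr)
qed (simp add: word_inv_def)

lemma group_free_group: "group (free_group n)"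
proof (rule groupI)
  fix x y assume "x \<in> carrier (free_group n)" "y \<in> carrier (free_group n)"
  then show "x \<otimes>\<^bsub>free_group n\<^esub> y \<in> carrier (free_group n)"
    using set_foldr_cancel_cons[of x y] by (fastforce simp: free_group_def reduced_foldr)
next
  fix x assume x: "x \<in> carrier (free_group n)"
  have "word_inv x \<in> carrier (free_group n)"
    using x by (auto simp: free_group_def reduced_word_inv) (auto simp: word_inv_def)
  moreover have "word_inv x \<otimes>\<^bsub>free_group n\<^esub> x = \<one>\<^bsub>free_group n\<^esub>"
    using x foldr_cancel_cons_word_inv[of "[]" x] by (simp add: free_group_def foldr_cancel_cons_Nil)
  ultimately show "\<exists>y\<in>carrier (free_group n). y \<otimes>\<^bsub>free_group n\<^esub> x = \<one>\<^bsub>free_group n\<^esub>" by blast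
qed (auto simp: free_group_def foldr_cancel_cons_assoc)

context group
begin

lemma letter_val_closed:
  "g \<in> {..<n} \<rightarrow> carrier G \<Longrightarrow> fst l < n \<Longrightarrow> letter_val G g l \<in> carrier G"
  by (auto simp: letter_val_def)

lemma word_eval_closed:
  assumes "g \<in> {..<n} \<rightarrow> carrier G" "fst ` set w \<subseteq> {..<n}"
  shows "word_eval G g w \<in> carrier G"
  using assms by (induction w) (auto simp: word_eval_def letter_val_closed)

lemma word_eval_cancel_cons:
  assumes g: "g \<in> {..<n} \<rightarrow> carrier G" and "fst l < n" "fst ` set w \<subseteq> {..<n}"
  shows "word_eval G g (cancel_cons l w) = letter_val G g l \<otimes> word_eval G g w"
proof (cases "(l, w)" rule: cancel_cons.cases)
  case (2 i b j c w')
  have "word_eval G g w' \<in> carrier G" "g i \<in> carrier G"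
    using assms 2 word_eval_closed[OF g, of w'] by auto
  with 2 show ?thesis
    by (auto simp: word_eval_def letter_val_def simp flip: m_assoc)
qed (auto simp: word_eval_def)

lemma word_eval_hom:
  assumes g: "g \<in> {..<n} \<rightarrow> carrier G"
  shows "word_eval G g \<in> hom (free_group n) G"
proof (rule homI)
  fix u v assume uv: "u \<in> carrier (free_group n)" "v \<in> carrier (free_group n)"
  have "fst ` set u \<subseteq> {..<n} \<Longrightarrow>
      word_eval G g (foldr cancel_cons u v) = word_eval G g u \<otimes> word_eval G g v"
  proof (induction u)
    case Nil
    then show ?case
      using uv word_eval_closed[OF g, of v] by (simp add: word_eval_def free_group_def)
  next
    case (Cons l u)
    have "fst ` set (foldr cancel_cons u v) \<subseteq> {..<n}"
      using Cons.prems uv set_foldr_cancel_cons[of u v] by (fastforce simp: free_group_def)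
    moreover have "word_eval G g u \<in> carrier G" "word_eval G g v \<in> carrier G"
      using Cons.prems uv by (auto intro!: word_eval_closed[OF g] simp: free_group_def)
    ultimately show ?case
      using Cons letter_val_closed[OF g, of l] word_eval_cancel_cons[OF g, of l "foldr cancel_cons u v"]
      by (simp add: word_eval_def m_assoc)
  qed
  then show "word_eval G g (u \<otimes>\<^bsub>free_group n\<^esub> v) = word_eval G g u \<otimes> word_eval G g v"
    using uv by (simp add: free_group_def)
qed (use word_eval_closed[OF g] in \<open>auto simp: free_group_def\<close>)

lemma word_eval_generator: "g i \<in> carrier G \<Longrightarrow> word_eval G g [(i, True)] = g i"
  by (simp add: word_eval_def letter_val_def)

end

lemma hom_word_eval:
  assumes "group G" "group H" "f \<in> hom G H" "g \<in> {..<n} \<rightarrow> carrier G" "fst ` set w \<subseteq> {..<n}"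
  shows "f (word_eval G g w) = word_eval H (f \<circ> g) w"
  using assms(5)
proof (induction w)
  case Nil
  then show ?case using hom_one[OF assms(3,1,2)] by (simp add: word_eval_def)
next
  case (Cons l w)
  interpret f: group_hom G H f
    using assms by (simp add: group_hom_def group_hom_axioms_def)
  have "letter_val G g l \<in> carrier G" "word_eval G g w \<in> carrier G"
    using f.G.letter_val_closed[OF assms(4), of l] f.G.word_eval_closed[OF assms(4), of w] Cons.prems
    by auto
  moreover have "f (letter_val G g l) = letter_val H (f \<circ> g) l"
    using assms(4) Cons.prems f.hom_inv[of "g (fst l)"] by (auto simp: letter_val_def Pi_iff)
  ultimately show ?case
    using Cons by (simp add: word_eval_def comp_def)
qed

lemma word_eval_free_group_generators:
  assumes "w \<in> carrier (free_group n)"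
  shows "word_eval (free_group n) (\<lambda>i. [(i, True)]) w = w"
proof -
  interpret F: group "free_group n" by (rule group_free_group)
  have inv: "inv\<^bsub>free_group n\<^esub> [(i, True)] = [(i, False)]" if "i < n" for i
    using that by (intro F.inv_equality) (auto simp: free_group_def reduced_def)
  have "reduced w \<Longrightarrow> fst ` set w \<subseteq> {..<n} \<Longrightarrow> ?thesis"
  proof (induction w)
    case (Cons l w)
    then show ?case
      using inv[of "fst l"] cancel_cons_reduced[of l w] reduced_ConsD[of l w]
      by (cases l) (auto simp: word_eval_def letter_val_def free_group_def)
  qed (simp add: word_eval_def free_group_def)
  then show ?thesis using assms by (simp add: free_group_def)
qed

lemma free_group_hom_unique:
  assumes "group H" "f \<in> hom (free_group n) H" "w \<in> carrier (free_group n)"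
  shows "f w = word_eval H (\<lambda>i. f [(i, True)]) w"
  using hom_word_eval[OF group_free_group assms(1,2), where g = "\<lambda>i. [(i, True)]" and n = n and w = w]
    word_eval_free_group_generators[OF assms(3)] assms(3)
  by (auto simp: comp_def free_group_def reduced_def)


section \<open>Independence of the type of the group elements\<close>

lemma word_image_iso:
  assumes "group G" "group H" "f \<in> iso G H" "w \<in> carrier (free_group n)"
  shows "word_image n H w = f ` word_image n G w"
proof -
  have hom: "f \<in> hom G H" and bij: "bij_betw f (carrier G) (carrier H)"
    using assms(3) by (auto simp: iso_def)
  have w: "fst ` set w \<subseteq> {..<n}" using assms(4) by (simp add: free_group_def)
  note ev = hom_word_eval[OF assms(1,2) hom _ w]
  show ?thesis
  proof (intro equalityI subsetI)
    fix y assume "y \<in> word_image n H w"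
    then obtain h where h: "h \<in> {..<n} \<rightarrow> carrier H" "y = word_eval H h w"
      by (auto simp: word_image_def)
    define g where "g = inv_into (carrier G) f \<circ> h"
    have g: "g \<in> {..<n} \<rightarrow> carrier G"
      using h bij_betw_apply[OF bij_betw_inv_into[OF bij]] by (auto simp: g_def Pi_iff)
    have "letter_val H (f \<circ> g) l = letter_val H h l" if "l \<in> set w" for l
    proof -
      have "h (fst l) \<in> carrier H" using w that h by auto
      then show ?thesis by (simp add: letter_val_def g_def bij_betw_inv_into_right[OF bij])
    qed
    then have "word_eval H (f \<circ> g) w = word_eval H h w"
      unfolding word_eval_def by (intro foldr_cong) auto
    then have "y = f (word_eval G g w)" using ev[OF g] h by simp
    then show "y \<in> f ` word_image n G w"
      using g by (auto simp: word_image_def)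
  next
    fix y assume "y \<in> f ` word_image n G w"
    then obtain g where g: "g \<in> {..<n} \<rightarrow> carrier G" "y = f (word_eval G g w)"
      by (auto simp: word_image_def)
    moreover have "f \<circ> g \<in> {..<n} \<rightarrow> carrier H"
      using g bij_betw_apply[OF bij] by (auto simp: Pi_iff)
    ultimately show "y \<in> word_image n H w"
      using ev[of g] by (auto simp: word_image_def)
  qed
qed

lemma countable_group_iso_nat:
  fixes G :: "('a, 'b) monoid_scheme"
  assumes "group G" "countable (carrier G)"
  obtains H :: "nat monoid" and f where "group H" "f \<in> iso G H"
proof -
  interpret group G by fact
  obtain f :: "'a \<Rightarrow> nat" where f: "inj_on f (carrier G)"
    using assms(2) by (auto simp: countable_def)
  define r where "r = inv_into (carrier G) f"
  have r: "r (f x) = x" if "x \<in> carrier G" for x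
    using f that by (simp add: r_def)
  define H where "H = \<lparr>carrier = f ` carrier G, mult = (\<lambda>x y. f (r x \<otimes>\<^bsub>G\<^esub> r y)), one = f \<one>\<^bsub>G\<^esub>\<rparr>"
  have "group H"
  proof (rule groupI)
    fix x assume "x \<in> carrier H"
    then obtain a where "a \<in> carrier G" "x = f a" by (auto simp: H_def)
    then show "\<exists>y\<in>carrier H. y \<otimes>\<^bsub>H\<^esub> x = \<one>\<^bsub>H\<^esub>"
      by (intro bexI[of _ "f (inv\<^bsub>G\<^esub> a)"]) (auto simp: H_def r)
  qed (auto simp: H_def r m_assoc)
  moreover have "f \<in> iso G H"
    using f by (auto simp: iso_def hom_def bij_betw_def H_def r)
  ultimately show ?thesis by (rule that)
qed

lemma surjective_wordD:
  fixes G :: "('a, 'b) monoid_scheme"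
  assumes "surjective_word n w" "group G"
  shows "word_image n G w = carrier G"
proof -
  interpret group G by fact
  have w: "w \<in> carrier (free_group n)" using assms(1) by (simp add: surjective_word_def)
  then have w': "fst ` set w \<subseteq> {..<n}" by (simp add: free_group_def)
  obtain Z :: "nat monoid" and f where Z: "group Z" "f \<in> iso integer_group Z"
    by (rule countable_group_iso_nat[of integer_group]) auto
  have "f ` word_image n integer_group w = f ` UNIV"
    using word_image_iso[OF _ Z w] assms(1) Z
    by (auto simp: surjective_word_def iso_def bij_betw_def)
  then have "word_image n integer_group w = UNIV"
    using Z(2) by (subst (asm) inj_image_eq_iff) (auto simp: iso_def bij_betw_def)
  then have "1 \<in> word_image n integer_group w" by simp
  then obtain a where a: "word_eval integer_group a w = 1"
    by (auto simp: word_image_def)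
  have "x \<in> word_image n G w" if x: "x \<in> carrier G" for x
  proof -
    have "(\<lambda>k::int. x [^]\<^bsub>G\<^esub> k) \<in> hom integer_group G"
      using hom_integer_group_pow[OF x] by simp
    from hom_word_eval[OF _ assms(2) this _ w', of a] a x
    have "x = word_eval G (\<lambda>i. x [^]\<^bsub>G\<^esub> a i) w" by (simp add: comp_def)
    then show ?thesis using x by (auto simp: word_image_def)
  qed
  moreover have "word_image n G w \<subseteq> carrier G"
    using word_eval_closed w' by (auto simp: word_image_def)
  ultimately show ?thesis by blast
qed

lemma finite_groups_universe:
  fixes G :: "('a, 'b) monoid_scheme"
  assumes "\<And>H :: nat monoid. group H \<Longrightarrow> finite (carrier H) \<Longrightarrow> word_image n H u = word_image n H w"
    and "u \<in> carrier (free_group n)" "w \<in> carrier (free_group n)"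
    and "group G" "finite (carrier G)"
  shows "word_image n G u = word_image n G w"
proof -
  obtain H :: "nat monoid" and f where H: "group H" "f \<in> iso G H"
    by (rule countable_group_iso_nat[OF \<open>group G\<close>]) (use assms(5) in \<open>auto intro: countable_finite\<close>)
  have "finite (carrier H)"
    using H(2) assms(5) bij_betw_finite by (auto simp: iso_def)
  then have "f ` word_image n G u = f ` word_image n G w"
    using assms(1)[OF H(1)] word_image_iso[OF \<open>group G\<close> H] assms(2,3) by metis
  moreover have "word_image n G v \<subseteq> carrier G" if "v \<in> carrier (free_group n)" for v
    using group.word_eval_closed[OF \<open>group G\<close>] that by (auto simp: word_image_def free_group_def)
  ultimately show ?thesis
    using H(2) assms(2,3) by (auto simp: iso_def bij_betw_def inj_on_image_eq_iff)
qed

end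

theory Submission
  imports Defs "HOL-Combinatorics.Permutations"
begin

text \<open>
  Let \<open>u\<close> have the same images as \<open>w\<^sup>d\<close>. The crucial point is that \<open>d\<close>-th powers are closed in the
  profinite topology of the free group. Up to conjugation \<open>u = v\<^sup>k\<close> with \<open>v\<close> cyclically reduced
  and not a proper power. Write \<open>v\<close> around a cycle of length \<open>\<bar>v\<bar>\<close>, extend the partial injections
  given by the letters to permutations of the vertices, and put voltages in \<open>\<int>/N\<close> on the edges
  of the cycle. This defines a homomorphism to the finite group \<open>\<int>/N \<wr> S\<^bsub>\<bar>v\<bar>\<^esub>\<close>. Each edge of the cycle
  has a large voltage and every other edge has voltage 0, so that a path reading \<open>u\<close> can
  accumulate as much voltage as the one at the base vertex only if it runs around the
  cycle, and then it starts at the base vertex, because \<open>v\<close> is not a proper power. A \<open>d\<close>-th root \<open>x\<close> of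
  the image of \<open>u\<close> commutes with that image, hence fixes the base vertex, so the total
  voltage of \<open>u\<close> there is \<open>d\<close> times that of \<open>x\<close>. As the total voltage is \<open>k\<close> modulo \<open>d\<close>, this
  gives \<open>d dvd k\<close>. For \<open>d = 0\<close> this applies to every positive exponent, whence \<open>u = 1\<close>.

  So \<open>u = y\<^sup>d\<close>, and an endomorphism mapping \<open>w\<close> to \<open>y\<close> maps \<open>w\<^sup>d\<close> to \<open>u\<close>. Conversely, the images
  in the finite cyclic groups show that \<open>u\<close> takes the value \<open>d\<close> in \<open>\<int>\<close>, say at \<open>a\<close>, and
  the endomorphism mapping \<open>x\<^sub>i\<close> to \<open>w\<close> to the power \<open>a\<^sub>i\<close> maps \<open>u\<close> to \<open>w\<^sup>d\<close>.
\<close>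

text \<open>The complements in \<open>S\<close> of \<open>D\<close> and of its image have the same
  finite cardinality; any bijection between them completes \<open>f\<close>.\<close>

lemma inj_on_extend_permutation:
  assumes "finite S" "D \<subseteq> S" "inj_on f D" "f ` D \<subseteq> S"
  obtains p where "p permutes S" "\<And>x. x \<in> D \<Longrightarrow> p x = f x"
proof -
  have "card (S - D) = card (S - f ` D)"
    using assms by (simp add: card_Diff_subset finite_subset card_image)
  then obtain h where h: "bij_betw h (S - D) (S - f ` D)"
    using assms(1) by (metis finite_Diff finite_same_card_bij)
  define p where "p x = (if x \<in> D then f x else if x \<in> S then h x else x)" for x
  have "bij_betw p D (f ` D)"
    using assms(3) by (simp add: bij_betw_def p_def inj_on_def)
  moreover have "bij_betw p (S - D) (S - f ` D)"
    using h by (subst bij_betw_cong[of _ p h]) (auto simp: p_def)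
  ultimately have "bij_betw p (D \<union> (S - D)) (f ` D \<union> (S - f ` D))"
    by (rule bij_betw_combine) auto
  then have "bij_betw p S S"
    using assms by (simp add: Un_absorb1)
  then have "p permutes S"
    using assms(2) by (intro bij_imp_permutes) (auto simp: p_def)
  then show ?thesis by (rule that) (simp add: p_def)
qed

section \<open>Wreath products of cyclic and symmetric groups\<close>

text \<open>In a product the right factor acts first; for \<open>(p, a)\<close>, the voltage picked
  up on leaving \<open>i\<close> is \<open>a i\<close>. Reduced residues and extensional functions
  keep the carrier finite.\<close>

definition cyclic_wreath :: "nat \<Rightarrow> int \<Rightarrow> ((nat \<Rightarrow> nat) \<times> (nat \<Rightarrow> int)) monoid" where
  "cyclic_wreath k N =
     \<lparr>carrier = {p. p permutes {..<k}} \<times> ({..<k} \<rightarrow>\<^sub>E {0..<N}),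
      monoid.mult = (\<lambda>(p, a) (q, b). (p \<circ> q, \<lambda>i\<in>{..<k}. (b i + a (q i)) mod N)),
      one = (id, \<lambda>i\<in>{..<k}. 0)\<rparr>"

lemma finite_cyclic_wreath: "finite (carrier (cyclic_wreath k N))"
  by (auto simp: cyclic_wreath_def intro!: finite_cartesian_product finite_permutations finite_PiE)

lemma permutes_lessThan: "p permutes {..<k} \<Longrightarrow> p i < k \<longleftrightarrow> i < (k :: nat)"
  using permutes_in_image[of p "{..<k}" i] by simp

lemma cyclic_wreath_left_inverse:
  assumes "p permutes {..<k}" "N > 0"
  shows "(inv_into UNIV p, \<lambda>i\<in>{..<k}. (- a (inv_into UNIV p i)) mod N) \<otimes>\<^bsub>cyclic_wreath k N\<^esub>
     (p, \<lambda>i\<in>{..<k}. a i mod N) = \<one>\<^bsub>cyclic_wreath k N\<^esub>"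
  by (simp add: cyclic_wreath_def permutes_lessThan[OF assms(1)] permutes_inv_o[OF assms(1)]
    permutes_inverses(2)[OF assms(1)] mod_simps cong: restrict_cong)

lemma group_cyclic_wreath:
  assumes N: "N > 0"
  shows "group (cyclic_wreath k N)"
proof (rule groupI)
  fix x y z
  assume "x \<in> carrier (cyclic_wreath k N)" "y \<in> carrier (cyclic_wreath k N)" "z \<in> carrier (cyclic_wreath k N)"
  then obtain p a q b r c where "x = (p, a)" "y = (q, b)" "z = (r, c)"
    and "p permutes {..<k}" "q permutes {..<k}" "r permutes {..<k}"
    unfolding cyclic_wreath_def by force
  then show "x \<otimes>\<^bsub>cyclic_wreath k N\<^esub> y \<otimes>\<^bsub>cyclic_wreath k N\<^esub> z =
     x \<otimes>\<^bsub>cyclic_wreath k N\<^esub> (y \<otimes>\<^bsub>cyclic_wreath k N\<^esub> z)"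
    by (simp add: cyclic_wreath_def permutes_lessThan mod_simps add.assoc comp_assoc cong: restrict_cong)
next
  fix x assume x: "x \<in> carrier (cyclic_wreath k N)"
  then obtain p a where pa: "x = (p, a)" "p permutes {..<k}" "a \<in> {..<k} \<rightarrow>\<^sub>E {0..<N}"
    by (auto simp: cyclic_wreath_def)
  have "(\<lambda>i\<in>{..<k}. a i mod N) = a"
    using pa(3) by (intro extensionalityI[of _ "{..<k}"]) (auto simp: PiE_iff)
  then have "(inv_into UNIV p, \<lambda>i\<in>{..<k}. (- a (inv_into UNIV p i)) mod N) \<otimes>\<^bsub>cyclic_wreath k N\<^esub> x =
      \<one>\<^bsub>cyclic_wreath k N\<^esub>"
    using cyclic_wreath_left_inverse[OF pa(2) N, of a] pa(1) by simp
  moreover have "(inv_into UNIV p, \<lambda>i\<in>{..<k}. (- a (inv_into UNIV p i)) mod N) \<in> carrier (cyclic_wreath k N)"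
    using pa N by (auto simp: cyclic_wreath_def permutes_inv)
  ultimately show "\<exists>y\<in>carrier (cyclic_wreath k N). y \<otimes>\<^bsub>cyclic_wreath k N\<^esub> x = \<one>\<^bsub>cyclic_wreath k N\<^esub>"
    by blast
  show "\<one>\<^bsub>cyclic_wreath k N\<^esub> \<otimes>\<^bsub>cyclic_wreath k N\<^esub> x = x"
    using pa \<open>(\<lambda>i\<in>{..<k}. a i mod N) = a\<close> by (simp add: cyclic_wreath_def permutes_lessThan cong: restrict_cong)
next
  fix x y assume "x \<in> carrier (cyclic_wreath k N)" "y \<in> carrier (cyclic_wreath k N)"
  then obtain p a q b where "x = (p, a)" "y = (q, b)" "p permutes {..<k}" "q permutes {..<k}"
    unfolding cyclic_wreath_def by force
  then show "x \<otimes>\<^bsub>cyclic_wreath k N\<^esub> y \<in> carrier (cyclic_wreath k N)"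
    using N by (simp add: cyclic_wreath_def permutes_compose)
qed (use N in \<open>simp add: cyclic_wreath_def\<close>)

lemma inv_cyclic_wreath:
  assumes p: "p permutes {..<k}" and N: "N > 0"
  shows "inv\<^bsub>cyclic_wreath k N\<^esub> (p, \<lambda>i\<in>{..<k}. a i mod N) =
    (inv_into UNIV p, \<lambda>i\<in>{..<k}. (- a (inv_into UNIV p i)) mod N)"
  using p N by (intro group.inv_equality[OF group_cyclic_wreath[OF N]] cyclic_wreath_left_inverse)
    (auto simp: cyclic_wreath_def permutes_inv)

section \<open>The labelled cycle\<close>

text \<open>
  The letter \<open>v ! i\<close> labels the edge from vertex \<open>i + 1\<close> to vertex \<open>i\<close> modulo \<open>length v\<close>: letters act
  from the left, so words are read from right to left.
\<close>

locale labelled_cycle =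
  fixes v :: word and B :: int
  assumes nonempty: "v \<noteq> []"
    and cyclically_reduced: "reduced (v @ v)"
    and B_nonneg: "B \<ge> 0"
begin

abbreviation "\<l> \<equiv> length v"

text \<open>The direction in which reading \<open>v\<close> moves: the cycle edge from
  \<open>j\<close> to \<open>pr j\<close> carries the letter \<open>v ! pr j\<close>.\<close>

definition pr :: "nat \<Rightarrow> nat" where
  "pr j = (if j = 0 then \<l> - 1 else j - 1)"

definition sc :: "nat \<Rightarrow> nat" where
  "sc i = (if Suc i = \<l> then 0 else Suc i)"

lemma length_pos: "\<l> > 0"
  using nonempty by simp

lemma pr_less [simp]: "j < \<l> \<Longrightarrow> pr j < \<l>" and sc_less [simp]: "i < \<l> \<Longrightarrow> sc i < \<l>"
  using length_pos by (auto simp: pr_def sc_def)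

lemma sc_pr [simp]: "j < \<l> \<Longrightarrow> sc (pr j) = j" and pr_sc [simp]: "i < \<l> \<Longrightarrow> pr (sc i) = i"
  using length_pos by (auto simp: pr_def sc_def)

text \<open>Reducedness of \<open>v @ v\<close> also covers the wrap-around from the last letter to
  the first.\<close>

lemma no_cancellation:
  assumes "i < \<l>" "v ! i = (s, b)" "v ! sc i = (s, c)"
  shows "b = c"
proof -
  have "Suc i < length (v @ v)" using assms(1) by auto
  then have "\<not> (fst ((v @ v) ! i) = fst ((v @ v) ! Suc i) \<and> snd ((v @ v) ! i) \<noteq> snd ((v @ v) ! Suc i))"
    using cyclically_reduced unfolding reduced_def successively_conv_nth by (simp add: case_prod_unfold)
  moreover have "(v @ v) ! Suc i = v ! sc i"
    using assms(1) by (auto simp: sc_def nth_append)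
  ultimately show ?thesis
    using assms by (simp add: nth_append)
qed

text \<open>If the moves prescribed for \<open>s\<close> were ambiguous or not injective,
  \<open>s\<close> and its inverse would label neighbouring edges of the cycle, contrary to cyclic
  reducedness. So they form a partial injection, which extends.\<close>

lemma ex_generator_permutation:
  "\<exists>p. p permutes {..<\<l>} \<and>
     (\<forall>j<\<l>. v ! pr j = (s, True) \<longrightarrow> p j = pr j) \<and>
     (\<forall>j<\<l>. v ! j = (s, False) \<longrightarrow> p j = sc j)"
proof -
  define D where "D = {j. j < \<l> \<and> (v ! pr j = (s, True) \<or> v ! j = (s, False))}"
  define f where "f j = (if v ! pr j = (s, True) then pr j else sc j)" for j
  have clash: False if "j < \<l>" "v ! pr j = (s, True)" "v ! j = (s, False)" for j
    using no_cancellation[of "pr j" s True False] that by simp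
  have clash': False if "i < \<l>" "j < \<l>" "v ! pr i = (s, True)" "v ! j = (s, False)" "pr i = sc j" for i j
    using no_cancellation[of j s False True] that by simp
  have "inj_on f D"
  proof (rule inj_onI)
    fix i j assume ij: "i \<in> D" "j \<in> D" "f i = f j"
    then have l: "i < \<l>" "j < \<l>" by (auto simp: D_def)
    have "pr i = pr j \<or> sc i = sc j"
      using ij(3) ij(1,2)[unfolded D_def mem_Collect_eq] clash'[of i j] clash'[of j i]
      unfolding f_def by metis
    then show "i = j" using l sc_pr pr_sc by metis
  qed
  moreover have "finite {..<\<l>}" "D \<subseteq> {..<\<l>}" "f ` D \<subseteq> {..<\<l>}"
    by (auto simp: D_def f_def)
  ultimately obtain p where p: "p permutes {..<\<l>}" "\<And>x. x \<in> D \<Longrightarrow> p x = f x"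
    using inj_on_extend_permutation by metis
  show ?thesis
    using p clash by (intro exI[of _ p]) (auto simp: D_def f_def)
qed

definition perm :: "nat \<Rightarrow> nat \<Rightarrow> nat" where
  "perm s = (SOME p. p permutes {..<\<l>} \<and>
     (\<forall>j<\<l>. v ! pr j = (s, True) \<longrightarrow> p j = pr j) \<and>
     (\<forall>j<\<l>. v ! j = (s, False) \<longrightarrow> p j = sc j))"

lemma perm:
  shows perm_permutes: "perm s permutes {..<\<l>}"
    and perm_True: "j < \<l> \<Longrightarrow> v ! pr j = (s, True) \<Longrightarrow> perm s j = pr j"
    and perm_False: "j < \<l> \<Longrightarrow> v ! j = (s, False) \<Longrightarrow> perm s j = sc j"
  using someI_ex[OF ex_generator_permutation[of s]] unfolding perm_def by blast+

abbreviation "perm_inv s \<equiv> inv_into UNIV (perm s)"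

text \<open>
  The edge 0 is distinguished in order that the total weight of the cycle is 1 modulo any divisor of \<open>B\<close>.
\<close>

definition weight :: "nat \<Rightarrow> int" where
  "weight i = B + (if i = 0 then 1 else 0)"

text \<open>The generator \<open>s\<close> runs forward through an edge labelled \<open>s\<close>
  and backward through one labelled by its inverse, hence the sign.\<close>

definition voltage :: "nat \<Rightarrow> nat \<Rightarrow> int" where
  "voltage s j = (if v ! pr j = (s, True) then weight (pr j)
     else if v ! j = (s, False) then - weight j else 0)"

fun st :: "nat \<times> bool \<Rightarrow> nat \<Rightarrow> nat" where
  "st (s, b) = (if b then perm s else perm_inv s)"

fun wt :: "nat \<times> bool \<Rightarrow> nat \<Rightarrow> int" where
  "wt (s, b) j = (if b then voltage s j else - voltage s (perm_inv s j))"

lemma weight_bounds: "0 \<le> weight i" "weight i \<le> B + 1"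
  using B_nonneg by (auto simp: weight_def)

lemma st_permutes: "st l permutes {..<\<l>}"
  by (cases l) (simp add: perm_permutes permutes_inv)

lemma wt_bound: "\<bar>wt l j\<bar> \<le> B + 1"
  using weight_bounds[of j] weight_bounds[of "pr j"] B_nonneg
    weight_bounds[of "perm_inv (fst l) j"] weight_bounds[of "pr (perm_inv (fst l) j)"]
  by (cases l) (auto simp: voltage_def abs_if)

lemma st_edge:
  assumes "j < \<l>" "l = v ! pr j"
  shows "st l j = pr j" "wt l j = weight (pr j)"
proof -
  obtain s b where l: "l = (s, b)" by force
  have "st l j = pr j \<and> wt l j = weight (pr j)"
  proof (cases b)
    case True
    then have "v ! pr j = (s, True)" using assms l by simp
    with True assms l show ?thesis by (simp add: perm_True voltage_def)
  next
    case False
    then have F: "v ! pr j = (s, False)" using assms l by simp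
    then have "perm s (pr j) = j" using perm_False[of "pr j" s] assms by simp
    then have "perm_inv s j = pr j"
      using permutes_inv_eq[OF perm_permutes] by simp
    \<comment> \<open>Cyclic reducedness excludes the first branch of
      \<open>voltage s (pr j)\<close>, so the second one applies.\<close>
    moreover have "v ! pr (pr j) \<noteq> (s, True)"
      using no_cancellation[of "pr (pr j)" s True False] F assms by auto
    ultimately show ?thesis using False l F by (simp add: voltage_def)
  qed
  then show "st l j = pr j" "wt l j = weight (pr j)" by auto
qed

text \<open>Positive voltage can only come from running forward along the cycle edge from
  \<open>j\<close> to \<open>pr j\<close>; cycle edges run backward and edges outside the cycle
  never give any.\<close>

lemma wt_off_edge:
  assumes "j < \<l>" "l \<noteq> v ! pr j"
  shows "wt l j \<le> 0"
proof -
  obtain s b where l: "l = (s, b)" by force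
  show ?thesis
  proof (cases b)
    case True
    with assms l weight_bounds[of j] show ?thesis by (auto simp: voltage_def)
  next
    case False
    define i where "i = perm_inv s j"
    have i: "perm s i = j" "i < \<l>"
      using permutes_inverses(1)[OF perm_permutes] permutes_lessThan[OF permutes_inv[OF perm_permutes]] assms
      by (auto simp: i_def)
    have "v ! i \<noteq> (s, False)"
      using perm_False[OF i(2)] i assms l False by auto
    with False l weight_bounds[of "pr i"] show ?thesis
      by (auto simp: voltage_def i_def)
  qed
qed

section \<open>Paths and their total voltage\<close>

abbreviation pos :: "word \<Rightarrow> nat \<Rightarrow> nat" where
  "pos xs j \<equiv> foldr st xs j"

text \<open>Kept unreduced in the integers so that sizes can be compared; only its residue modulo
  \<open>N\<close> is visible in the wreath product.\<close>

fun tot :: "word \<Rightarrow> nat \<Rightarrow> int" where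
  "tot [] j = 0"
| "tot (l # xs) j = tot xs j + wt l (pos xs j)"

fun along :: "word \<Rightarrow> nat \<Rightarrow> bool" where
  "along [] j = True"
| "along (l # xs) j = (along xs j \<and> l = v ! pr (pos xs j))"

lemma pos_permutes: "(\<lambda>j. pos xs j) permutes {..<\<l>}"
proof (induction xs)
  case (Cons l xs)
  then show ?case using permutes_compose[OF Cons st_permutes[of l]] by (simp add: comp_def)
qed (simp add: permutes_id[unfolded id_def])

lemma pos_less: "j < \<l> \<Longrightarrow> pos xs j < \<l>"
  using permutes_lessThan[OF pos_permutes] by simp

lemma tot_append: "tot (xs @ ys) j = tot ys j + tot xs (pos ys j)"
  by (induction xs) auto

lemma along_append: "along (xs @ ys) j \<longleftrightarrow> along ys j \<and> along xs (pos ys j)"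
  by (induction xs) auto

lemma tot_bound: "\<bar>tot xs j\<bar> \<le> int (length xs) * (B + 1)"
proof (induction xs)
  case (Cons l xs)
  then show ?case using wt_bound[of l "pos xs j"] by (simp add: algebra_simps)
qed simp

text \<open>A step off the cycle gains at most 0 instead of the maximum \<open>B + 1\<close>. This
  gap detects paths that leave the cycle.\<close>

lemma tot_not_along:
  assumes "j < \<l>" "\<not> along xs j"
  shows "tot xs j \<le> (int (length xs) - 1) * (B + 1)"
  using assms(2)
proof (induction xs)
  case (Cons l xs)
  show ?case
  proof (cases "along xs j")
    case True
    then have "wt l (pos xs j) \<le> 0"
      using wt_off_edge Cons.prems pos_less[OF assms(1)] by auto
    then show ?thesis using tot_bound[of xs j] by simp
  next
    case False
    then show ?thesis using Cons.IH wt_bound[of l "pos xs j"] by (simp add: algebra_simps)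
  qed
qed simp

lemma pr_mod: "0 < i \<Longrightarrow> i \<le> \<l> \<Longrightarrow> pr (i mod \<l>) = i - 1"
  by (cases "i = \<l>") (auto simp: pr_def)

text \<open>Each letter read along the cycle lowers the vertex by one, so the word read is the
  factor of \<open>v\<close> ending just before position \<open>j\<close>. The form
  \<open>j mod \<l>\<close> lets vertex 0 also count as \<open>\<l>\<close>, from which a path can
  descend.\<close>

lemma along_imp_factor:
  assumes "along xs (j mod \<l>)" "length xs \<le> j" "j \<le> \<l>"
  shows "xs = take (length xs) (drop (j - length xs) v) \<and> pos xs (j mod \<l>) = (j - length xs) mod \<l>"
  using assms
proof (induction xs)
  case (Cons l xs)
  define i where "i = j - length xs"
  have i: "0 < i" "i \<le> \<l>" and IH: "xs = take (length xs) (drop i v)" "pos xs (j mod \<l>) = i mod \<l>"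
    using Cons by (auto simp: i_def)
  then have l: "l = v ! (i - 1)" using Cons.prems pr_mod by simp
  have "drop (i - 1) v = l # drop i v"
    using Cons_nth_drop_Suc[of "i - 1" v] i l by simp
  moreover have "pos (l # xs) (j mod \<l>) = i - 1"
    using st_edge(1)[of "i mod \<l>" l] IH i l pr_mod length_pos by simp
  moreover have "j - length (l # xs) = i - 1" by (simp add: i_def)
  ultimately show ?case using IH(1) i by simp
qed simp

text \<open>Split \<open>v = y @ x\<close> with \<open>length x = j\<close>. First \<open>x\<close>
  leads from \<open>j\<close> down to 0, so it is a prefix of \<open>v\<close>; then
  \<open>y\<close> leads from 0, counted as \<open>\<l>\<close>, down to \<open>j\<close>.\<close>

lemma along_imp_rotation:
  assumes "along v j" "j < \<l>"
  shows "v = drop j v @ take j v"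
proof -
  define x y where "x = drop (\<l> - j) v" and "y = take (\<l> - j) v"
  have xy: "v = y @ x" and len: "length x = j" "length y = \<l> - j"
    using assms(2) by (simp_all add: x_def y_def)
  have ax: "along x j" and ay: "along y (pos x j)"
    using assms(1) along_append[of y x j] xy by auto
  have x: "x = take j v" "pos x j = 0"
    using along_imp_factor[of x j] ax len assms(2) by auto
  then have "along y (\<l> mod \<l>)" using ay by simp
  then have "y = drop j v"
    using along_imp_factor[of y \<l>] len assms(2) by simp
  with xy x show ?thesis by simp
qed

lemma pos_tot_cycle: "pos v 0 = 0 \<and> tot v 0 = int \<l> * B + 1"
proof -
  \<comment> \<open>Words are read from the right, so the induction runs over suffixes, from
    \<open>\<l>\<close> down to 0; edge 0 comes last and adds the 1.\<close>
  have "i \<le> \<l> \<Longrightarrow> pos (drop i v) 0 = i mod \<l> \<and>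
      tot (drop i v) 0 = int (\<l> - i) * B + (if i = 0 then 1 else 0)" for i
  proof (induction rule: inc_induct)
    case (step i)
    have d: "drop i v = v ! i # drop (Suc i) v"
      using step by (simp add: Cons_nth_drop_Suc)
    have p: "pr (Suc i mod \<l>) = i" using pr_mod[of "Suc i"] step by simp
    have "int (\<l> - i) = int (\<l> - Suc i) + 1" using step by simp
    then show ?case
      using step st_edge[of "Suc i mod \<l>" "v ! i"] length_pos unfolding d
      by (simp add: p weight_def algebra_simps)
  qed (use nonempty in simp)
  from this[of 0] show ?thesis by simp
qed

lemma pos_tot_concat_replicate:
  "pos (concat (replicate k v)) 0 = 0 \<and> tot (concat (replicate k v)) 0 = int k * (int \<l> * B + 1)"
proof (induction k)
  case (Suc k)
  then show ?case using pos_tot_cycle by (simp add: tot_append algebra_simps)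
qed simp

section \<open>Evaluation in the wreath product\<close>

definition gen :: "int \<Rightarrow> nat \<Rightarrow> (nat \<Rightarrow> nat) \<times> (nat \<Rightarrow> int)" where
  "gen N s = (perm s, \<lambda>j\<in>{..<\<l>}. voltage s j mod N)"

lemma gen_closed: "N > 0 \<Longrightarrow> gen N s \<in> carrier (cyclic_wreath \<l> N)"
  by (auto simp: gen_def cyclic_wreath_def perm_permutes)

lemma word_eval_gen:
  assumes N: "N > 0"
  shows "word_eval (cyclic_wreath \<l> N) (gen N) xs = (\<lambda>j. pos xs j, \<lambda>j\<in>{..<\<l>}. tot xs j mod N)"
proof (induction xs)
  case Nil
  then show ?case by (simp add: word_eval_def cyclic_wreath_def id_def restrict_def fun_eq_iff)
next
  case (Cons l xs)
  have "letter_val (cyclic_wreath \<l> N) (gen N) l = (st l, \<lambda>j\<in>{..<\<l>}. wt l j mod N)"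
    by (cases l) (simp add: letter_val_def gen_def inv_cyclic_wreath[OF perm_permutes N])
  moreover have "(\<lambda>j. foldr st (l # xs) j) = st l \<circ> (\<lambda>j. foldr st xs j)" by (simp add: comp_def)
  ultimately show ?case using Cons
    by (auto simp: word_eval_def cyclic_wreath_def pos_less mod_simps intro!: restrict_ext)
qed

end

lemma pow_cyclic_wreath_fixed_point:
  assumes "q 0 = 0" "k > 0"
  shows "fst ((q, b) [^]\<^bsub>cyclic_wreath k N\<^esub> m) 0 = 0 \<and>
    snd ((q, b) [^]\<^bsub>cyclic_wreath k N\<^esub> m) 0 = (int m * b 0) mod N"
proof (induction m)
  case (Suc m)
  obtain p a where pa: "(q, b) [^]\<^bsub>cyclic_wreath k N\<^esub> m = (p, a)" by force
  have "(q, b) [^]\<^bsub>cyclic_wreath k N\<^esub> Suc m =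
      (p \<circ> q, \<lambda>i\<in>{..<k}. (b i + a (q i)) mod N)"
    using pa by (simp add: nat_pow_def cyclic_wreath_def)
  then show ?case using Suc pa assms by (simp add: mod_simps algebra_simps)
qed (use assms in \<open>simp add: nat_pow_def cyclic_wreath_def\<close>)

text \<open>The hypothesis on rotations says that \<open>v\<close> is not a proper power. One
  well-chosen wreath product serves as the test.\<close>

lemma dvd_exponent_of_power_in_finite_groups:
  assumes v: "v \<noteq> []" "reduced (v @ v)"
    and primitive: "\<And>j. 0 < j \<Longrightarrow> j < length v \<Longrightarrow> drop j v @ take j v \<noteq> v"
    and k: "k > 0" and m: "m > 0"
    and power: "\<And>(G :: ((nat \<Rightarrow> nat) \<times> (nat \<Rightarrow> int)) monoid) g. group G \<Longrightarrow> finite (carrier G) \<Longrightarrow>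
      g \<in> UNIV \<rightarrow> carrier G \<Longrightarrow> \<exists>x\<in>carrier G. word_eval G g (concat (replicate k v)) = x [^]\<^bsub>G\<^esub> m"
  shows "m dvd k"
proof -
  define c where "c = concat (replicate k v)"
  \<comment> \<open>Divisible by \<open>m\<close>, so that the cycle has total 1 modulo
    \<open>m\<close>, and at least \<open>length c\<close>, so that the loss from one step off the
    cycle cannot be made up.\<close>
  define B where "B = int (m * k * length v)"
  \<comment> \<open>Divisible by \<open>m\<close>, so that congruences descend to \<open>m\<close>,
    and larger than any difference of totals of \<open>c\<close>, so that congruent totals are
    equal.\<close>
  define N where "N = int m * (2 * (int (length c) * (B + 1)) + 1)"
  interpret labelled_cycle v B
    using v by unfold_locales (simp_all add: B_def)
  define W where "W = cyclic_wreath \<l> N"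
  have len: "length c = k * \<l>" by (simp add: c_def length_concat sum_list_replicate)
  have "0 \<le> int (length c) * (B + 1)" using B_nonneg by simp
  moreover have "1 * (2 * (int (length c) * (B + 1)) + 1) \<le> N"
    unfolding N_def using calculation m by (intro mult_right_mono) auto
  ultimately have N: "N > 0" and N_large: "2 * (int (length c) * (B + 1)) < N"
    by simp_all
  interpret W: group W unfolding W_def by (rule group_cyclic_wreath[OF N])
  obtain x where x: "x \<in> carrier W" "word_eval W (gen N) c = x [^]\<^bsub>W\<^esub> m"
    using power[of W "gen N"] W.group_axioms finite_cyclic_wreath gen_closed[OF N]
    unfolding W_def c_def by blast
  obtain q b where qb: "x = (q, b)" by force
  have q: "q permutes {..<\<l>}" using x(1) by (simp add: qb W_def cyclic_wreath_def)
  have eval: "x [^]\<^bsub>W\<^esub> m = (\<lambda>j. pos c j, \<lambda>j\<in>{..<\<l>}. tot c j mod N)"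
    using x(2) word_eval_gen[OF N] by (simp add: W_def)
  have c0: "pos c 0 = 0" "tot c 0 = int k * (int \<l> * B + 1)"
    using pos_tot_concat_replicate by (simp_all add: c_def)
  define j where "j = q 0"
  have j: "j < \<l>" using permutes_lessThan[OF q] length_pos by (simp add: j_def)
  \<comment> \<open>Comparing both products at 0 makes \<open>b 0\<close> cancel: \<open>x\<close>
    moves 0 to a vertex where \<open>c\<close> has the same total modulo \<open>N\<close>.\<close>
  have "x [^]\<^bsub>W\<^esub> m \<otimes>\<^bsub>W\<^esub> x = x \<otimes>\<^bsub>W\<^esub> x [^]\<^bsub>W\<^esub> m"
    using W.nat_pow_comm[OF x(1), of m 1] x(1) by simp
  then have "snd (x [^]\<^bsub>W\<^esub> m \<otimes>\<^bsub>W\<^esub> x) 0 = snd (x \<otimes>\<^bsub>W\<^esub> x [^]\<^bsub>W\<^esub> m) 0"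
    by simp
  then have "(b 0 + tot c j) mod N = (tot c 0 + b 0) mod N"
    using length_pos j c0(1) unfolding eval unfolding qb by (simp add: W_def cyclic_wreath_def j_def mod_simps)
  then have "N dvd tot c j - tot c 0"
    by (simp add: mod_eq_dvd_iff algebra_simps)
  moreover have "\<bar>tot c j - tot c 0\<bar> < N"
    using tot_bound[of c j] tot_bound[of c 0] N_large by linarith
  ultimately have eq: "tot c j = tot c 0"
    using zdvd_imp_le[of N "\<bar>tot c j - tot c 0\<bar>"] by fastforce
  have "length c \<le> m * k * \<l>"
    using mult_le_mono1[of 1 m "k * \<l>"] m by (simp add: len mult.assoc)
  then have "int (length c) \<le> B"
    unfolding B_def by (rule of_nat_mono)
  then have "(int (length c) - 1) * (B + 1) < tot c 0"
    using k by (simp add: c0 len algebra_simps)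
  then have "along c j"
    using tot_not_along[OF j, of c] eq by auto
  moreover obtain k' where "k = Suc k'" using k by (cases k) auto
  then have "c = concat (replicate k' v) @ v"
    by (simp add: c_def flip: replicate_append_same)
  \<comment> \<open>The rightmost copy of \<open>v\<close> is read first, so it starts at
    \<open>j\<close> itself.\<close>
  ultimately have "along v j" by (simp add: along_append)
  then have "j = 0"
    using along_imp_rotation[OF _ j] primitive[of j] j by fastforce
  then have "tot c 0 mod N = (int m * b 0) mod N"
    using pow_cyclic_wreath_fixed_point[where q = q and k = \<l> and b = b and N = N and m = m] eval length_pos
    by (simp add: qb W_def j_def)
  then have "int m dvd tot c 0 - int m * b 0"
    by (metis N_def dvd_triv_left dvd_trans mod_eq_dvd_iff)
  then have "int m dvd tot c 0"
    by (metis dvd_diff_commute dvd_triv_left zdvd_zdiffD)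
  moreover have "tot c 0 = int k + int m * (int k * int k * int \<l> * int \<l>)"
    unfolding c0(2) unfolding B_def by (simp add: algebra_simps)
  ultimately show ?thesis
    by (metis dvd_add_left_iff dvd_triv_left int_dvd_int_iff)
qed

section \<open>Powers in free groups\<close>

text \<open>A word equal to a proper rotation of itself splits into two commuting nonempty pieces,
  hence is a proper power of a shorter word.\<close>

lemma ex_primitive_root:
  assumes "c \<noteq> []"
  shows "\<exists>k v. k > 0 \<and> c = concat (replicate k v) \<and>
    (\<forall>j. 0 < j \<longrightarrow> j < length v \<longrightarrow> drop j v @ take j v \<noteq> v)"
  using assms
proof (induction c rule: length_induct)
  case (1 c)
  show ?case
  proof (cases "\<exists>j. 0 < j \<and> j < length c \<and> drop j c @ take j c = c")
    case False
    then show ?thesis by (intro exI[of _ 1] exI[of _ c]) auto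
  next
    case True
    then obtain j where j: "0 < j" "j < length c" "drop j c @ take j c = c" by blast
    then have "take j c @ drop j c = drop j c @ take j c" by simp
    then obtain n z where nz: "n > 1" "concat (replicate n z) = c"
      using comm_append_is_replicate[of "take j c" "drop j c"] j by fastforce
    have "length c = n * length z"
      using nz(2)[symmetric] by (simp add: length_concat sum_list_replicate)
    then have "z \<noteq> []" "length z < length c"
      using nz(1) 1(2) by auto
    then obtain k v where kv: "k > 0" "z = concat (replicate k v)"
      "\<forall>j. 0 < j \<longrightarrow> j < length v \<longrightarrow> drop j v @ take j v \<noteq> v"
      using 1(1) by blast
    have "concat (replicate i (concat (replicate k v))) = concat (replicate (i * k) v)" for i
      by (induction i) (simp_all add: replicate_add)
    then show ?thesis
      using kv nz by (intro exI[of _ "n * k"] exI[of _ v]) auto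
  qed
qed

lemma reduced_appendD: "reduced (u @ v) \<Longrightarrow> reduced u \<and> reduced v"
  by (simp add: reduced_def successively_append_iff)

lemma mult_free_group_append:
  assumes "reduced (u @ v)"
  shows "u \<otimes>\<^bsub>free_group n\<^esub> v = u @ v"
proof -
  have "foldr cancel_cons u v = foldr cancel_cons u (foldr cancel_cons v [])"
    using reduced_appendD[OF assms] foldr_cancel_cons_Nil by simp
  also have "\<dots> = u @ v"
    using foldr_cancel_cons_Nil[OF assms] by simp
  finally show ?thesis by (simp add: free_group_def)
qed

lemma pow_free_group_concat_replicate:
  assumes "reduced (concat (replicate k v))"
  shows "v [^]\<^bsub>free_group n\<^esub> k = concat (replicate k v)"
  using assms
proof (induction k)
  case 0
  then show ?case by (simp add: free_group_def)
next
  case (Suc k)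
  have *: "concat (replicate (Suc k) v) = concat (replicate k v) @ v"
    by (simp flip: replicate_append_same)
  then show ?case
    using Suc reduced_appendD[of "concat (replicate k v)" v]
      mult_free_group_append[of "concat (replicate k v)" v n] by simp
qed

lemma inv_free_group_letter:
  assumes "i < n"
  shows "inv\<^bsub>free_group n\<^esub> [(i, b)] = [(i, \<not> b)]"
  using assms by (intro group.inv_equality[OF group_free_group]) (auto simp: free_group_def reduced_def)

text \<open>If \<open>u @ u\<close> is not reduced, the first and last letters of \<open>u\<close>
  are mutually inverse; stripping them is a conjugation that shortens the word.\<close>

lemma conjugate_cyclically_reduced:
  assumes "u \<in> carrier (free_group n)"
  shows "\<exists>h\<in>carrier (free_group n). \<exists>c\<in>carrier (free_group n).
    reduced (c @ c) \<and> u = h \<otimes>\<^bsub>free_group n\<^esub> c \<otimes>\<^bsub>free_group n\<^esub> inv\<^bsub>free_group n\<^esub> h"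
  using assms
proof (induction u rule: length_induct)
  case (1 u)
  interpret F: group "free_group n" by (rule group_free_group)
  have u: "reduced u" "fst ` set u \<subseteq> {..<n}" using 1(2) by (auto simp: free_group_def)
  show ?case
  proof (cases "reduced (u @ u)")
    case True
    then show ?thesis using 1(2) by (intro bexI[of _ "\<one>\<^bsub>free_group n\<^esub>"] bexI[of _ u]) auto
  next
    case False
    then have "u \<noteq> []" and cancel: "fst (last u) = fst (hd u)" "snd (last u) \<noteq> snd (hd u)"
      using u(1) by (auto simp: reduced_def successively_append_iff case_prod_unfold)
    obtain i b where hd: "hd u = (i, b)" by force
    have last: "last u = (i, \<not> b)" using cancel hd by (cases "last u") auto
    obtain u' where u': "u = (i, b) # u'" using hd \<open>u \<noteq> []\<close> by (cases u) auto
    then have "u' \<noteq> []" using last by auto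
    then obtain x where x: "u = [(i, b)] @ x @ [(i, \<not> b)]"
      using last u' by (cases u' rule: rev_cases) auto
    have i: "i < n" using u(2) x by auto
    have red: "reduced ([(i, b)] @ x @ [(i, \<not> b)])" using u(1) x by simp
    have xF: "x \<in> carrier (free_group n)"
      using reduced_appendD[OF red] reduced_appendD[of x "[(i, \<not> b)]"] u(2)[unfolded x]
      by (simp add: free_group_def)
    have lF: "[(i, c)] \<in> carrier (free_group n)" for c
      using i by (simp add: free_group_def reduced_def)
    have "u = [(i, b)] \<otimes>\<^bsub>free_group n\<^esub> (x \<otimes>\<^bsub>free_group n\<^esub> [(i, \<not> b)])"
      using mult_free_group_append[OF red] mult_free_group_append[of x "[(i, \<not> b)]"]
        reduced_appendD[OF red] x by simp
    then have ux: "u = [(i, b)] \<otimes>\<^bsub>free_group n\<^esub> (x \<otimes>\<^bsub>free_group n\<^esub> inv\<^bsub>free_group n\<^esub> [(i, b)])"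
      using inv_free_group_letter[OF i] by simp
    have "length x < length u" using x by simp
    then obtain h c where hc: "h \<in> carrier (free_group n)" "c \<in> carrier (free_group n)" "reduced (c @ c)"
      "x = h \<otimes>\<^bsub>free_group n\<^esub> c \<otimes>\<^bsub>free_group n\<^esub> inv\<^bsub>free_group n\<^esub> h"
      using 1(1) xF by blast
    have "u = ([(i, b)] \<otimes>\<^bsub>free_group n\<^esub> h) \<otimes>\<^bsub>free_group n\<^esub> c
      \<otimes>\<^bsub>free_group n\<^esub> inv\<^bsub>free_group n\<^esub> ([(i, b)] \<otimes>\<^bsub>free_group n\<^esub> h)"
      unfolding ux hc(4) using hc(1,2) lF by (simp add: F.m_assoc F.inv_mult_group)
    then show ?thesis
      using hc lF by (intro bexI[of _ "[(i, b)] \<otimes>\<^bsub>free_group n\<^esub> h"] bexI[of _ c]) auto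
  qed
qed

lemma (in group) nat_pow_conjugate:
  assumes "h \<in> carrier G" "x \<in> carrier G"
  shows "(h \<otimes> x \<otimes> inv h) [^] (m :: nat) = h \<otimes> x [^] m \<otimes> inv h"
proof (induction m)
  case (Suc m)
  have "inv h \<otimes> (h \<otimes> y) = y" if "y \<in> carrier G" for y
    using assms that by (simp flip: m_assoc)
  then show ?case using Suc assms by (simp add: m_assoc)
qed (use assms in simp)

text \<open>The element type is the one of \<open>cyclic_wreath\<close>, whose groups suffice as tests.\<close>

definition power_in_finite_groups :: "nat \<Rightarrow> nat \<Rightarrow> word \<Rightarrow> bool" where
  "power_in_finite_groups n m u \<longleftrightarrow>
     (\<forall>(G :: ((nat \<Rightarrow> nat) \<times> (nat \<Rightarrow> int)) monoid) g. group G \<longrightarrow> finite (carrier G) \<longrightarrow>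
        g \<in> {..<n} \<rightarrow> carrier G \<longrightarrow> (\<exists>x\<in>carrier G. word_eval G g u = x [^]\<^bsub>G\<^esub> m))"

text \<open>One \<open>k\<close>, chosen before \<open>m\<close>, bounds all exponents; this will
  settle the exponent 0. Conjugation carries roots of \<open>u\<close> to roots of a power of the
  primitive word \<open>v\<close> and back.\<close>

lemma ex_bound_power_in_finite_groups:
  assumes u: "u \<in> carrier (free_group n)" "u \<noteq> []"
  shows "\<exists>k>0. \<forall>m>0. power_in_finite_groups n m u \<longrightarrow>
    m dvd k \<and> (\<exists>y\<in>carrier (free_group n). u = y [^]\<^bsub>free_group n\<^esub> m)"
proof -
  interpret F: group "free_group n" by (rule group_free_group)
  obtain h c where hc: "h \<in> carrier (free_group n)" "c \<in> carrier (free_group n)" "reduced (c @ c)"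
      "u = h \<otimes>\<^bsub>free_group n\<^esub> c \<otimes>\<^bsub>free_group n\<^esub> inv\<^bsub>free_group n\<^esub> h"
    using conjugate_cyclically_reduced[OF u(1)] by blast
  have "c \<noteq> []"
    using hc u(2) F.r_inv[of h] by (auto simp: free_group_def foldr_cancel_cons_Nil)
  then obtain k v where kv: "k > 0" "c = concat (replicate k v)"
    and prim: "\<And>j. 0 < j \<Longrightarrow> j < length v \<Longrightarrow> drop j v @ take j v \<noteq> v"
    using ex_primitive_root by metis
  have "v \<noteq> []" using kv \<open>c \<noteq> []\<close> by auto
  obtain k' where k': "k = Suc k'" using kv(1) by (cases k) auto
  have cons: "c = v @ concat (replicate k' v)" by (simp add: kv(2) k')
  have snoc: "c = concat (replicate k' v) @ v" by (simp add: kv(2) k' flip: replicate_append_same)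
  have "c @ c = concat (replicate k' v) @ (v @ v) @ concat (replicate k' v)"
    by (subst snoc, subst cons) simp
  then have vv: "reduced (v @ v)"
    using hc(3) by (metis reduced_appendD)
  have "m dvd k \<and> (\<exists>y\<in>carrier (free_group n). u = y [^]\<^bsub>free_group n\<^esub> m)"
    if m: "m > 0" and pow: "power_in_finite_groups n m u" for m
  proof -
    have dvd: "m dvd k"
    proof (rule dvd_exponent_of_power_in_finite_groups[OF \<open>v \<noteq> []\<close> vv prim kv(1) m])
      fix G :: "((nat \<Rightarrow> nat) \<times> (nat \<Rightarrow> int)) monoid" and g :: "nat \<Rightarrow> _"
      assume G: "group G" "finite (carrier G)" and g: "g \<in> UNIV \<rightarrow> carrier G"
      interpret G: group G by fact
      have g': "g \<in> {..<n} \<rightarrow> carrier G" using g by auto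
      interpret e: group_hom "free_group n" G "word_eval G g"
        using G.word_eval_hom[OF g'] by unfold_locales
      obtain x where x: "x \<in> carrier G" "word_eval G g u = x [^]\<^bsub>G\<^esub> m"
        using pow G g' unfolding power_in_finite_groups_def by blast
      have "inv\<^bsub>free_group n\<^esub> h \<otimes>\<^bsub>free_group n\<^esub> (h \<otimes>\<^bsub>free_group n\<^esub> c) = c"
        using hc(1,2) by (simp flip: F.m_assoc)
      then have "inv\<^bsub>free_group n\<^esub> h \<otimes>\<^bsub>free_group n\<^esub> (u \<otimes>\<^bsub>free_group n\<^esub> h) = c"
        using hc(1,2) unfolding hc(4) by (simp add: F.m_assoc)
      then have "word_eval G g c = inv\<^bsub>G\<^esub> word_eval G g h \<otimes>\<^bsub>G\<^esub> (word_eval G g u \<otimes>\<^bsub>G\<^esub> word_eval G g h)"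
        using hc(1) u(1) by (metis F.inv_closed F.m_closed e.hom_inv e.hom_mult)
      also have "\<dots> = (inv\<^bsub>G\<^esub> word_eval G g h \<otimes>\<^bsub>G\<^esub> x \<otimes>\<^bsub>G\<^esub> word_eval G g h) [^]\<^bsub>G\<^esub> m"
        using G.nat_pow_conjugate[of "inv\<^bsub>G\<^esub> word_eval G g h" x m] hc(1) x by (simp add: G.m_assoc)
      finally show "\<exists>x\<in>carrier G. word_eval G g (concat (replicate k v)) = x [^]\<^bsub>G\<^esub> m"
        unfolding kv(2)[symmetric] by (rule bexI) (use hc(1) x(1) in simp)
    qed
    then obtain r where r: "k = m * r" ..
    have v: "v \<in> carrier (free_group n)"
      using hc(2) reduced_appendD[OF vv] unfolding cons by (simp add: free_group_def image_Un)
    have "reduced (concat (replicate k v))"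
      using reduced_appendD[OF hc(3)] unfolding kv(2) by blast
    then have "c = v [^]\<^bsub>free_group n\<^esub> k"
      unfolding kv(2) by (rule pow_free_group_concat_replicate[symmetric])
    then have "c = (v [^]\<^bsub>free_group n\<^esub> r) [^]\<^bsub>free_group n\<^esub> m"
      using v by (simp add: F.nat_pow_pow r mult.commute)
    then have "u = (h \<otimes>\<^bsub>free_group n\<^esub> v [^]\<^bsub>free_group n\<^esub> r \<otimes>\<^bsub>free_group n\<^esub> inv\<^bsub>free_group n\<^esub> h) [^]\<^bsub>free_group n\<^esub> m"
      using hc(1,4) v by (simp add: F.nat_pow_conjugate)
    then show ?thesis using dvd v hc(1) by blast
  qed
  then show ?thesis using kv(1) by blast
qed

lemma power_if_power_in_finite_groups:
  assumes u: "u \<in> carrier (free_group n)" and pow: "power_in_finite_groups n m u"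
  shows "\<exists>y\<in>carrier (free_group n). u = y [^]\<^bsub>free_group n\<^esub> m"
proof (cases "u = []")
  case True
  interpret F: group "free_group n" by (rule group_free_group)
  have "u = \<one>\<^bsub>free_group n\<^esub> [^]\<^bsub>free_group n\<^esub> m" by (simp add: True) (simp add: free_group_def)
  then show ?thesis by blast
next
  case False
  then obtain k where k: "k > 0" "\<And>m. m > 0 \<Longrightarrow> power_in_finite_groups n m u \<Longrightarrow>
      m dvd k \<and> (\<exists>y\<in>carrier (free_group n). u = y [^]\<^bsub>free_group n\<^esub> m)"
    using ex_bound_power_in_finite_groups[OF u] by blast
  have "m > 0"
  proof (rule ccontr)
    assume "\<not> m > 0"
    \<comment> \<open>With exponent 0 all values of \<open>u\<close> are the identity, which is a
      power to any exponent, even one above the bound \<open>k\<close>.\<close>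
    then have "power_in_finite_groups n (Suc k) u"
      using pow unfolding power_in_finite_groups_def
      by (metis group.is_monoid monoid.nat_pow_one monoid.one_closed nat_pow_0 not_gr_zero)
    then have "Suc k dvd k" using k(2) by blast
    then show False using k(1) dvd_imp_le[of "Suc k" k] by simp
  qed
  then show ?thesis using k(2) pow by blast
qed

lemma (in group) nat_pow_abs:
  fixes d :: int
  assumes "x \<in> carrier G"
  shows "x [^] nat \<bar>d\<bar> = (if d \<ge> 0 then x [^] d else inv x [^] d)"
proof (cases "d \<ge> 0")
  case True
  then show ?thesis using int_pow_int[of G x "nat d"] by simp
next
  case False
  then have "x [^] nat \<bar>d\<bar> = x [^] (- d)" using int_pow_int[of G x "nat (-d)"] by simp
  then show ?thesis using False assms by (simp add: int_pow_neg int_pow_inv)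
qed

text \<open>Inversion permutes the group, so the sign of the exponent does not affect the set of
  powers.\<close>

lemma (in group) nat_pow_abs_iff:
  "(\<exists>x\<in>carrier G. y = x [^] nat \<bar>d\<bar>) \<longleftrightarrow> (\<exists>x\<in>carrier G. y = x [^] (d :: int))"
proof (cases "d \<ge> 0")
  case True
  then show ?thesis by (simp add: nat_pow_abs cong: bex_cong)
next
  case False
  then have "(\<exists>x\<in>carrier G. y = x [^] nat \<bar>d\<bar>) \<longleftrightarrow> (\<exists>x\<in>carrier G. y = inv x [^] d)"
    by (simp add: nat_pow_abs int_pow_neg int_pow_inv cong: bex_cong)
  then show ?thesis by (metis inv_closed inv_inv)
qed

section \<open>Values in finite cyclic groups\<close>

lemma word_eval_cong:
  assumes "fst ` set w \<subseteq> {..<n}" "\<And>i. i < n \<Longrightarrow> f i = g i"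
  shows "word_eval G f w = word_eval G g w"
  unfolding word_eval_def using assms by (intro foldr_cong) (auto simp: letter_val_def)

lemma word_image_int_pow:
  assumes w: "surjective_word n w" and G: "group G"
  shows "word_image n G (w [^]\<^bsub>free_group n\<^esub> (d :: int)) = (\<lambda>x. x [^]\<^bsub>G\<^esub> d) ` carrier G"
proof -
  have wF: "w \<in> carrier (free_group n)" using w by (simp add: surjective_word_def)
  have "word_eval G g (w [^]\<^bsub>free_group n\<^esub> d) = word_eval G g w [^]\<^bsub>G\<^esub> d" if "g \<in> {..<n} \<rightarrow> carrier G" for g
    using hom_int_pow[OF group.word_eval_hom[OF G that] wF group_free_group G] .
  moreover have "word_image n G x = (\<lambda>g. word_eval G g x) ` ({..<n} \<rightarrow> carrier G)" for x
    by (auto simp: word_image_def)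
  ultimately have "word_image n G (w [^]\<^bsub>free_group n\<^esub> d) = (\<lambda>x. x [^]\<^bsub>G\<^esub> d) ` word_image n G w"
    by (simp add: image_image cong: image_cong_simp)
  then show ?thesis using surjective_wordD[OF w G] by simp
qed

lemma word_eval_integer_group:
  "word_eval integer_group (\<lambda>i. r * a i + b i) w = r * word_eval integer_group a w + word_eval integer_group b w"
  by (induction w) (auto simp: word_eval_def letter_val_def algebra_simps)

text \<open>The values of \<open>u\<close> in the integers form a subgroup. If it is generated by
  some \<open>g > 0\<close>, testing modulo \<open>g\<close> shows that \<open>d\<close> is a
  multiple of \<open>g\<close>; if it is trivial, a modulus above the size of \<open>d\<close>
  forces \<open>d = 0\<close>.\<close>

lemma in_word_image_integer_group:
  assumes u: "u \<in> carrier (free_group n)"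
    and mod: "\<And>m. m > 0 \<Longrightarrow> d mod int m \<in> word_image n (integer_mod_group m) u"
  shows "d \<in> word_image n integer_group u"
proof -
  define I where "I = range (\<lambda>a. word_eval integer_group a u)"
  have I: "word_image n integer_group u = I" by (auto simp: I_def word_image_def)
  have lin: "r * x + y \<in> I" if "x \<in> I" "y \<in> I" for r x y
    using that unfolding I_def by (auto simp flip: word_eval_integer_group)
  have zero: "0 \<in> I"
    using lin[of "word_eval integer_group (\<lambda>i. 0) u" "word_eval integer_group (\<lambda>i. 0) u" "-1"]
    by (simp add: I_def)
  have u': "fst ` set u \<subseteq> {..<n}" using u by (simp add: free_group_def)
  have ex: "\<exists>x\<in>I. d mod int m = x mod int m" if m: "m > 0" for m
  proof -
    obtain a where a: "a \<in> {..<n} \<rightarrow> carrier (integer_mod_group m)"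
      "d mod int m = word_eval (integer_mod_group m) a u"
      using mod[OF m] by (auto simp: word_image_def)
    have "(\<lambda>x. x mod int m) \<in> hom integer_group (integer_mod_group m)"
      using m by (intro homI) (auto simp: carrier_integer_mod_group mod_simps)
    from hom_word_eval[OF _ _ this _ u', of a]
    have "word_eval integer_group a u mod int m = word_eval (integer_mod_group m) ((\<lambda>x. x mod int m) \<circ> a) u"
      by simp
    also have "\<dots> = word_eval (integer_mod_group m) a u"
      using a(1) m by (intro word_eval_cong[OF u']) (auto simp: carrier_integer_mod_group Pi_iff)
    finally show ?thesis using a(2) by (intro bexI[of _ "word_eval integer_group a u"]) (simp_all add: I_def)
  qed
  show ?thesis
  proof (cases "I = {0}")
    case True
    then have "d mod int (nat \<bar>d\<bar> + 1) = 0" using ex[of "nat \<bar>d\<bar> + 1"] by simp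
    then have "(\<bar>d\<bar> + 1) dvd d" by (simp add: mod_0_imp_dvd add.commute)
    then have "d = 0" using zdvd_imp_le[of "\<bar>d\<bar> + 1" "\<bar>d\<bar>"] by fastforce
    then show ?thesis using zero I by simp
  next
    case False
    then obtain x where "x \<in> I" "x \<noteq> 0" using zero by blast
    then have "\<exists>g::nat. g > 0 \<and> int g \<in> I"
      using lin[of x 0 1] lin[of x 0 "-1"] zero by (intro exI[of _ "nat \<bar>x\<bar>"]) (auto simp: abs_if)
    then obtain g where g: "g > 0" "int g \<in> I" and min: "\<And>g'. g' < g \<Longrightarrow> \<not> (g' > 0 \<and> int g' \<in> I)"
      using exists_least_iff[of "\<lambda>g. g > 0 \<and> int g \<in> I"] by blast
    have "int g dvd x" if "x \<in> I" for x
    proof -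
      have "x mod int g \<in> I"
        using lin[OF g(2) that, of "- (x div int g)"] by (simp add: minus_div_mult_eq_mod [symmetric] algebra_simps)
      moreover have "0 \<le> x mod int g" "x mod int g < int g" using g(1) by simp_all
      ultimately have "x mod int g = 0"
        using min[of "nat (x mod int g)"] by (cases "x mod int g = 0") (auto simp: nat_less_iff)
      then show ?thesis by auto
    qed
    then have "int g dvd d"
      using ex[OF g(1)] by (metis dvd_imp_mod_0 mod_0_imp_dvd)
    then obtain r where "d = r * int g + 0" by (metis add.right_neutral dvdE mult.commute)
    then show ?thesis using lin[OF g(2) zero, of r] I by simp
  qed
qed

section \<open>The two endomorphisms\<close>

theorem corollary4p5:
  fixes n :: nat and w :: word and d :: int
  assumes "w \<in> carrier (free_group n)"
    and "surjective_word n w"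
  shows "weakly_profinitely_rigid n (w [^]\<^bsub>free_group n\<^esub> d)"
  unfolding weakly_profinitely_rigid_def
proof (intro conjI ballI impI)
  interpret F: group "free_group n" by (rule group_free_group)
  show wd: "w [^]\<^bsub>free_group n\<^esub> d \<in> carrier (free_group n)"
    using assms(1) by simp
  fix u assume u: "u \<in> carrier (free_group n)"
    and "\<forall>G :: nat monoid. group G \<and> finite (carrier G) \<longrightarrow>
      word_image n G u = word_image n G (w [^]\<^bsub>free_group n\<^esub> d)"
  then have image: "word_image n G u = (\<lambda>x. x [^]\<^bsub>G\<^esub> d) ` carrier G"
    if "group G" "finite (carrier G)" for G :: "'b monoid"
    using finite_groups_universe[OF _ u wd that] word_image_int_pow[OF assms(2) that(1)] by simp
  show "endomorphic_equivalent (free_group n) u (w [^]\<^bsub>free_group n\<^esub> d)"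
    unfolding endomorphic_equivalent_def
  proof (intro conjI u wd)
    have u': "fst ` set u \<subseteq> {..<n}" using u by (simp add: free_group_def)
    have "d mod int m \<in> word_image n (integer_mod_group m) u" if "m > 0" for m
    proof (subst image)
      \<comment> \<open>The form \<open>1 mod int m\<close> covers \<open>m = 1\<close>, where the
        carrier contains only 0.\<close>
      have "d mod int m = (1 mod int m) [^]\<^bsub>integer_mod_group m\<^esub> d"
        by (simp add: int_pow_integer_mod_group mod_simps)
      then show "d mod int m \<in> (\<lambda>x. x [^]\<^bsub>integer_mod_group m\<^esub> d) ` carrier (integer_mod_group m)"
        using that by (auto simp: carrier_integer_mod_group)
    qed (use that in \<open>simp_all add: carrier_integer_mod_group\<close>)
    then have "d \<in> word_image n integer_group u"
      by (rule in_word_image_integer_group[OF u])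
    then obtain a where a: "word_eval integer_group a u = d"
      by (auto simp: word_image_def)
    \<comment> \<open>The endomorphism given by \<open>g\<close> evaluates \<open>u\<close> at
      \<open>a\<close> and carries the result along the homomorphism from the integers that sends 1
      to \<open>w\<close>.\<close>
    define g where "g = (\<lambda>i. w [^]\<^bsub>free_group n\<^esub> a i)"
    have g: "g \<in> {..<n} \<rightarrow> carrier (free_group n)" using assms(1) by (simp add: g_def)
    have "word_eval (free_group n) g u = w [^]\<^bsub>free_group n\<^esub> d"
      using hom_word_eval[OF _ group_free_group F.hom_integer_group_pow[OF assms(1)], of a n u] u' a
      by (simp add: g_def comp_def)
    moreover have "power_in_finite_groups n (nat \<bar>d\<bar>) u"
      unfolding power_in_finite_groups_def
    proof (intro allI impI)
      fix G :: "((nat \<Rightarrow> nat) \<times> (nat \<Rightarrow> int)) monoid" and g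
      assume G: "group G" "finite (carrier G)" and "g \<in> {..<n} \<rightarrow> carrier G"
      then have "word_eval G g u \<in> (\<lambda>x. x [^]\<^bsub>G\<^esub> d) ` carrier G"
        using image[OF G] by (auto simp: word_image_def)
      then obtain x where "x \<in> carrier G" "word_eval G g u = x [^]\<^bsub>G\<^esub> d" by blast
      then show "\<exists>x\<in>carrier G. word_eval G g u = x [^]\<^bsub>G\<^esub> nat \<bar>d\<bar>"
        using group.nat_pow_abs_iff[OF G(1)] by metis
    qed
    then obtain y where "y \<in> carrier (free_group n)" "u = y [^]\<^bsub>free_group n\<^esub> nat \<bar>d\<bar>"
      using power_if_power_in_finite_groups[OF u] by blast
    then obtain z where z: "z \<in> carrier (free_group n)" "u = z [^]\<^bsub>free_group n\<^esub> d"
      using F.nat_pow_abs_iff by metis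
    \<comment> \<open>Surjectivity is applied to the free group itself: substituting
      \<open>f\<close> sends \<open>w\<close> to \<open>z\<close>, hence the power of
      \<open>w\<close> to \<open>u\<close>.\<close>
    then obtain f where f: "f \<in> {..<n} \<rightarrow> carrier (free_group n)" "z = word_eval (free_group n) f w"
      using surjective_wordD[OF assms(2) group_free_group[of n]] by (auto simp: word_image_def)
    have "word_eval (free_group n) f (w [^]\<^bsub>free_group n\<^esub> d) = u"
      using hom_int_pow[OF F.word_eval_hom[OF f(1)] assms(1) group_free_group group_free_group] f z by simp
    ultimately show "\<exists>\<phi>\<^sub>1\<in>hom (free_group n) (free_group n). \<exists>\<phi>\<^sub>2\<in>hom (free_group n) (free_group n).
        \<phi>\<^sub>1 u = w [^]\<^bsub>free_group n\<^esub> d \<and> \<phi>\<^sub>2 (w [^]\<^bsub>free_group n\<^esub> d) = u"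
      using F.word_eval_hom[OF f(1)] F.word_eval_hom[OF g] by blast
  qed
qed

end
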